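(* Let $X$ and $Y$ be non-negative random variables with distributions $F$ and $G$ respectively, where $G(0-)=0$ and $G(0)<1$. Let $H$ be the distribution of $XY$. Suppose that (A) for any $c>0$, $\overline{G}(cx)=o[\overline{H}(x)]$ as $x\to\infty$; (B) there exists a function $h:[0,\infty)\to(0,\infty)$ such that $\mathbf{P}[X>x\mid Y=y]\sim h(y)\,\mathbf{P}[X>x]$ as $x\to\infty$, uniformly for $y\in S_Y$. If $F\in\mathcal{OL}$, then $H\in\mathcal{OL}$.
   Context: For a distribution $F$ write $\overline{F}:=1-F$; throughout $\overline{F}(x)>0$ for all $x\ge 0$. $H(x):=\mathbf{P}[XY\le x]$. $S_Y$ is the support of $Y$. Uniformity in (B) means $\lim_{x\to\infty}\sup_{y\in S_Y}\left|\frac{\mathbf{P}[X>x\mid Y=y]}{h(y)\mathbf{P}[X>x]}-1\right|=0$. $F\in\mathcal{OL}$ (generalized long tailed) if for all (equivalently, for some) $a>0$, $\limsup_{x\to\infty}\overline{F}(x-a)/\overline{F}(x)<\infty$. *)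

theory Defs
  imports "HOL-Probability.Probability" "HOL-Library.Landau_Symbols"
begin

definition survival :: "(real \<Rightarrow> real) \<Rightarrow> real \<Rightarrow> real" where
  "survival F x = 1 - F x"

(* The positivity clause is the standing convention that tails never vanish; it also keeps the
   quotient clear of division by zero. *)
definition generalized_long_tailed :: "(real \<Rightarrow> real) \<Rightarrow> bool" where
  "generalized_long_tailed F \<longleftrightarrow>
     (\<forall>x\<ge>0. survival F x > 0) \<and>
     (\<forall>a>0. Limsup at_top (\<lambda>x. ereal (survival F (x - a) / survival F x)) < \<infinity>)"

definition measure_support :: "'a::topological_space measure \<Rightarrow> 'a set" where
  "measure_support N = {y. \<forall>U. open U \<longrightarrow> y \<in> U \<longrightarrow> emeasure N U > 0}"

(* K y is a version of the conditional law of X given Y = y.  A jointly measurable kernel is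
   required, rather than one Radon-Nikodym derivative for each event separately, so that
   P[X > x | Y = y] is a probability law in X for every single y.  Such a K always exists for
   real-valued X and is unique up to a null set of values of Y. *)
definition regular_conditional_law ::
  "'a measure \<Rightarrow> ('a \<Rightarrow> real) \<Rightarrow> ('a \<Rightarrow> real) \<Rightarrow> (real \<Rightarrow> real measure) \<Rightarrow> bool" where
  "regular_conditional_law M X Y K \<longleftrightarrow>
     K \<in> borel \<rightarrow>\<^sub>M prob_algebra borel \<and>
     (\<forall>A\<in>sets borel. \<forall>B\<in>sets borel.
        measure M {\<omega> \<in> space M. X \<omega> \<in> A \<and> Y \<omega> \<in> B} =
        (LINT y:B|distr M borel Y. measure (K y) A))"

end

theory Submission
  imports Defs
begin

text \<open>
Write \<open>\<mu>\<close> for the law of \<open>Y\<close>. The task is to bound \<open>P[XY > x - a]\<close> by a constant multiple of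
\<open>P[XY > x]\<close> for large \<open>x\<close>. Given \<open>Y = y > 0\<close>, the first event says \<open>X > x/y - a/y\<close>, so what matters
is a shift of the tail of \<open>X\<close> by \<open>a/y\<close>. The bound on such shifts that \<open>F\<close> provides needs \<open>a/y\<close>
bounded and \<open>x/y\<close> large. Fix \<open>d > 0\<close> with \<open>P[Y > d] > 0\<close> and a large \<open>T\<close>; the three ranges
of \<open>Y\<close> below then cover everything.

\<^item> For \<open>d/2 < Y \<le> x/T\<close>, shifts are at most \<open>2a/d\<close> and \<open>x/y \<ge> T\<close>. The long-tail property of \<open>F\<close>
  passes to the conditional laws: by the uniform equivalence in (B) the ratio of two conditional
  tails given \<open>Y = y\<close> is at most three times the corresponding ratio of tails of \<open>F\<close>, because
  the factor \<open>h y\<close> cancels (\<open>uniform_tail_equivalence_imp_comparable\<close>). Integrating over \<open>y\<close>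
  (\<open>prob_tail_le_of_kernel_tail_le\<close>) gives a multiple of \<open>P[XY > x]\<close>.

\<^item> For \<open>Y \<le> d/2\<close>, the shift may be huge, but \<open>X\<close> must exceed \<open>2(x - a)/d \<ge> x/d\<close>. On the other hand
  \<open>XY > x\<close> holds as soon as \<open>X > x/d\<close> and \<open>Y > d\<close>. Since the conditional tails given \<open>Y > d\<close> are
  comparable with the tail of \<open>F\<close>, the latter event has probability at least a constant times
  \<open>P[X > x/d]\<close>.

\<^item> For \<open>Y > x/T\<close>, assumption (A) says that the probability is negligible against \<open>P[XY > x]\<close>.

The function \<open>h\<close> need not be measurable, so it is never integrated: only quotients in which it has
cancelled enter an integral. As (B) speaks about points of the support, these pointwise bounds hold
\<open>\<mu>\<close>-almost everywhere by \<open>AE_measure_support\<close>.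
\<close>

section \<open>The support of a measure\<close>

text \<open>
The complement of the support is covered by the null members of a countable base.
\<close>

lemma AE_measure_support:
  fixes N :: "'a::second_countable_topology measure"
  assumes sets_N: "sets N = sets borel"
  shows "AE y in N. y \<in> measure_support N"
proof -
  obtain D :: "'a set set" where D: "countable D" "topological_basis D"
    using ex_countable_basis by blast
  define E where "E = {U \<in> D. emeasure N U = 0}"
  have "\<Union>E \<in> null_sets N"
  proof (rule null_sets_UN'[where N = "\<lambda>U. U" and I = E, simplified])
    show "countable E"
      using D(1) by (rule countable_subset[rotated]) (auto simp: E_def)
    show "U \<in> null_sets N" if "U \<in> E" for U
      using that topological_basis_open[OF D(2)] by (auto simp: E_def null_sets_def sets_N)
  qed
  moreover have "{y \<in> space N. y \<notin> measure_support N} \<subseteq> \<Union>E"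
  proof safe
    fix y assume "y \<notin> measure_support N"
    then obtain U where U: "open U" "y \<in> U" "emeasure N U = 0"
      by (auto simp: measure_support_def)
    obtain V where V: "V \<in> D" "y \<in> V" "V \<subseteq> U"
      using topological_basisE[OF D(2) U(1,2)] .
    have "emeasure N V \<le> emeasure N U"
      using V(3) U(1) by (intro emeasure_mono) (auto simp: sets_N)
    with U(3) V show "y \<in> \<Union>E" by (auto simp: E_def)
  qed
  ultimately show ?thesis by (rule AE_I')
qed

lemma measure_support_subset_closed:
  fixes N :: "'a::topological_space measure"
  assumes "sets N = sets borel" and "closed S" and "AE y in N. y \<in> S"
  shows "measure_support N \<subseteq> S"
proof
  fix y assume y: "y \<in> measure_support N"
  have "emeasure N (- S) = 0"
    using assms by (subst AE_iff_measurable[symmetric, of _ _ "\<lambda>y. y \<in> S"])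
      (auto simp: sets_eq_imp_space_eq[OF assms(1)])
  with y assms(2) show "y \<in> S"
    by (fastforce simp: measure_support_def open_Compl)
qed

section \<open>Events disintegrated along the conditional law\<close>

context prob_space
begin

text \<open>
The defining equation of a conditional law covers rectangles only, whereas \<open>XY > x\<close> is an event under
a hyperbola. Composing the law of \<open>Y\<close> with the kernel gives a measure on the plane that agrees with
the joint law on rectangles; as these are stable under intersection and generate, the two coincide.
\<close>

lemma joint_law_of_regular_conditional_law:
  assumes X[measurable]: "X \<in> borel_measurable M" and Y[measurable]: "Y \<in> borel_measurable M"
    and rcl: "regular_conditional_law M X Y K"
    and S: "S \<in> sets (borel \<Otimes>\<^sub>M borel)"
  shows "emeasure M {\<omega> \<in> space M. (X \<omega>, Y \<omega>) \<in> S} =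
    (\<integral>\<^sup>+ y. emeasure (K y) {x. (x, y) \<in> S} \<partial>distr M borel Y)"
proof -
  let ?P = "borel \<Otimes>\<^sub>M borel :: (real \<times> real) measure"
  let ?E = "{A \<times> B | A B. A \<in> sets (borel :: real measure) \<and> B \<in> sets (borel :: real measure)}"
  define L where "L y = distr (K y) ?P (\<lambda>x. (x, y))" for y
  define J where "J = distr M borel Y \<bind> L"
  have K_prob: "K \<in> borel \<rightarrow>\<^sub>M prob_algebra borel"
    and K_rect: "\<And>A B. A \<in> sets borel \<Longrightarrow> B \<in> sets borel \<Longrightarrow>
      measure M {\<omega> \<in> space M. X \<omega> \<in> A \<and> Y \<omega> \<in> B} = (LINT y:B|distr M borel Y. measure (K y) A)"
    using rcl by (auto simp: regular_conditional_law_def)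
  have K[measurable]: "K \<in> borel \<rightarrow>\<^sub>M subprob_algebra borel"
    by (rule measurable_prob_algebraD[OF K_prob])
  have K_sets[measurable_cong]: "sets (K y) = sets borel" and K_ps: "prob_space (K y)" for y
    using measurable_space[OF K_prob, of y] by (auto simp: space_prob_algebra)
  have K_meas: "(\<lambda>y. measure (K y) A) \<in> borel_measurable borel" if "A \<in> sets borel" for A :: "real set"
    using measurable_compose[OF K_prob measurable_measure_prob_algebra[OF that]] .
  have L[measurable]: "L \<in> borel \<rightarrow>\<^sub>M subprob_algebra ?P"
    unfolding L_def by (rule measurable_distr2[where M = borel]) measurable
  have J_sets[simp]: "sets J = sets ?P"
    unfolding J_def by (rule sets_bind_measurable[where B = ?P]) auto
  have J_emeasure: "emeasure J T = (\<integral>\<^sup>+ y. emeasure (K y) {x. (x, y) \<in> T} \<partial>distr M borel Y)"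
    if T: "T \<in> sets ?P" for T
  proof -
    have "emeasure J T = (\<integral>\<^sup>+ y. emeasure (L y) T \<partial>distr M borel Y)"
      unfolding J_def by (rule emeasure_bind[OF _ _ T]) auto
    also have "\<dots> = (\<integral>\<^sup>+ y. emeasure (K y) {x. (x, y) \<in> T} \<partial>distr M borel Y)"
    proof (rule nn_integral_cong)
      fix y
      show "emeasure (L y) T = emeasure (K y) {x. (x, y) \<in> T}"
        unfolding L_def using T
        by (subst emeasure_distr)
          (auto simp: vimage_def sets_eq_imp_space_eq[OF K_sets])
    qed
    finally show ?thesis .
  qed
  interpret JD: prob_space "distr M ?P (\<lambda>\<omega>. (X \<omega>, Y \<omega>))"
    by (rule prob_space_distr) measurable
  have "distr M ?P (\<lambda>\<omega>. (X \<omega>, Y \<omega>)) = J"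
  proof (rule measure_eqI_generator_eq[OF Int_stable_pair_measure_generator[of borel borel],
        where \<Omega> = UNIV and A = "\<lambda>_. UNIV"])
    show "sets (distr M ?P (\<lambda>\<omega>. (X \<omega>, Y \<omega>))) = sigma_sets UNIV ?E" "sets J = sigma_sets UNIV ?E"
      by (simp_all add: sets_pair_measure)
    show "range (\<lambda>_. UNIV) \<subseteq> ?E"
      by (auto intro!: exI[of _ UNIV])
    fix T assume "T \<in> ?E"
    then obtain A B where T: "T = A \<times> B" and A[measurable]: "A \<in> sets borel"
      and B[measurable]: "B \<in> sets borel" by blast
    have int: "integrable (distr M borel Y) (\<lambda>y. indicator B y *\<^sub>R measure (K y) A)"
    proof (rule finite_measure.integrable_const_bound[where B = 1])
      show "finite_measure (distr M borel Y)"
        by (intro prob_space.finite_measure prob_space_distr) simp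
      show "AE y in distr M borel Y. norm (indicator B y *\<^sub>R measure (K y) A) \<le> 1"
        by (intro AE_I2) (auto simp: indicator_def prob_space.prob_le_1[OF K_ps])
      show "(\<lambda>y. indicator B y *\<^sub>R measure (K y) A) \<in> borel_measurable (distr M borel Y)"
        using K_meas[OF A] by measurable
    qed
    have "emeasure (distr M ?P (\<lambda>\<omega>. (X \<omega>, Y \<omega>))) T = emeasure M {\<omega> \<in> space M. X \<omega> \<in> A \<and> Y \<omega> \<in> B}"
      by (subst emeasure_distr) (auto simp: T intro!: arg_cong[where f = "emeasure M"])
    also have "\<dots> = ennreal (LINT y:B|distr M borel Y. measure (K y) A)"
      by (simp add: emeasure_eq_measure K_rect)
    also have "\<dots> = (\<integral>\<^sup>+ y. ennreal (indicator B y *\<^sub>R measure (K y) A) \<partial>distr M borel Y)"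
      unfolding set_lebesgue_integral_def
      by (rule nn_integral_eq_integral[OF int, symmetric]) simp
    also have "\<dots> = (\<integral>\<^sup>+ y. emeasure (K y) {x. (x, y) \<in> T} \<partial>distr M borel Y)"
      by (intro nn_integral_cong)
        (auto simp: T indicator_def finite_measure.emeasure_eq_measure[OF prob_space.finite_measure[OF K_ps]])
    also have "\<dots> = emeasure J T"
      by (rule J_emeasure[symmetric]) (simp add: T)
    finally show "emeasure (distr M ?P (\<lambda>\<omega>. (X \<omega>, Y \<omega>))) T = emeasure J T" .
  qed auto
  then have "emeasure J S = emeasure M {\<omega> \<in> space M. (X \<omega>, Y \<omega>) \<in> S}"
    using S by (auto simp: emeasure_distr vimage_def Int_def conj_commute
        dest!: arg_cong[where f = "\<lambda>N. emeasure N S"])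
  with J_emeasure[OF S] show ?thesis by simp
qed

text \<open>
The thresholds may depend on \<open>y\<close>: for the product the relevant ones are \<open>x / y\<close>, and
the shift by \<open>a\<close> compares \<open>(x - a) / y\<close> with \<open>x / y\<close>.
\<close>

lemma prob_tail_le_of_kernel_tail_le:
  assumes X[measurable]: "X \<in> borel_measurable M" and Y[measurable]: "Y \<in> borel_measurable M"
    and rcl: "regular_conditional_law M X Y K"
    and [measurable]: "s \<in> borel_measurable borel" "t \<in> borel_measurable borel" "B \<in> sets borel"
    and c: "0 \<le> c"
    and le: "AE y in distr M borel Y. y \<in> B \<longrightarrow> measure (K y) {s y<..} \<le> c * measure (K y) {t y<..}"
  shows "\<P>(\<omega> in M. s (Y \<omega>) < X \<omega> \<and> Y \<omega> \<in> B) \<le> c * \<P>(\<omega> in M. t (Y \<omega>) < X \<omega> \<and> Y \<omega> \<in> B)"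
proof -
  have K_prob: "K \<in> borel \<rightarrow>\<^sub>M prob_algebra borel"
    using rcl by (simp add: regular_conditional_law_def)
  have K[measurable]: "K \<in> borel \<rightarrow>\<^sub>M subprob_algebra borel"
    by (rule measurable_prob_algebraD[OF K_prob])
  have K_ps: "prob_space (K y)" for y
    using measurable_space[OF K_prob, of y] by (auto simp: space_prob_algebra)
  have joint: "emeasure M {\<omega> \<in> space M. r (Y \<omega>) < X \<omega> \<and> Y \<omega> \<in> B} =
      (\<integral>\<^sup>+ y. emeasure (K y) {r y<..} * indicator B y \<partial>distr M borel Y)"
    and tail_measurable: "(\<lambda>y. emeasure (K y) {r y<..}) \<in> borel_measurable borel"
    if [measurable]: "r \<in> borel_measurable borel" for r
  proof -
    have S: "{p. r (snd p) < fst p \<and> snd p \<in> B} \<in> sets (borel \<Otimes>\<^sub>M borel :: (real \<times> real) measure)"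
    proof -
      have "{p \<in> space (borel \<Otimes>\<^sub>M borel). r (snd p) < fst p \<and> snd p \<in> B}
          \<in> sets (borel \<Otimes>\<^sub>M borel :: (real \<times> real) measure)" by measurable
      then show ?thesis by (simp add: space_pair_measure)
    qed
    have "(SIGMA y:space borel. {r y<..}) \<in> sets (borel \<Otimes>\<^sub>M borel :: (real \<times> real) measure)"
    proof -
      have "{p \<in> space (borel \<Otimes>\<^sub>M borel). r (fst p) < snd p}
          \<in> sets (borel \<Otimes>\<^sub>M borel :: (real \<times> real) measure)" by measurable
      also have "{p \<in> space (borel \<Otimes>\<^sub>M borel). r (fst p) < snd p} = (SIGMA y:space borel. {r y<..})"
        by (auto simp: space_pair_measure)
      finally show ?thesis .
    qed
    then show "(\<lambda>y. emeasure (K y) {r y<..}) \<in> borel_measurable borel"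
      by (rule emeasure_measurable_subprob_algebra2) measurable
    have "emeasure (K y) {x. r y < x \<and> y \<in> B} = emeasure (K y) {r y<..} * indicator B y" for y
      by (auto simp: indicator_def greaterThan_def)
    then show "emeasure M {\<omega> \<in> space M. r (Y \<omega>) < X \<omega> \<and> Y \<omega> \<in> B} =
      (\<integral>\<^sup>+ y. emeasure (K y) {r y<..} * indicator B y \<partial>distr M borel Y)"
      using joint_law_of_regular_conditional_law[OF X Y rcl S] by simp
  qed
  have [measurable]: "(\<lambda>y. emeasure (K y) {t y<..}) \<in> borel_measurable borel"
    by (rule tail_measurable) measurable
  have "emeasure M {\<omega> \<in> space M. s (Y \<omega>) < X \<omega> \<and> Y \<omega> \<in> B} =
      (\<integral>\<^sup>+ y. emeasure (K y) {s y<..} * indicator B y \<partial>distr M borel Y)"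
    by (rule joint) measurable
  also have "\<dots> \<le> (\<integral>\<^sup>+ y. ennreal c * (emeasure (K y) {t y<..} * indicator B y) \<partial>distr M borel Y)"
  proof (rule nn_integral_mono_AE, use le in eventually_elim)
    case (elim y)
    then show ?case
      using c by (auto simp: indicator_def ennreal_mult'[symmetric]
          finite_measure.emeasure_eq_measure[OF prob_space.finite_measure[OF K_ps]])
  qed
  also have "\<dots> = ennreal c * (\<integral>\<^sup>+ y. emeasure (K y) {t y<..} * indicator B y \<partial>distr M borel Y)"
    by (rule nn_integral_cmult) measurable
  also have "\<dots> = ennreal c * emeasure M {\<omega> \<in> space M. t (Y \<omega>) < X \<omega> \<and> Y \<omega> \<in> B}"
    by (subst joint) measurable
  finally show ?thesis
    using c by (simp add: emeasure_eq_measure ennreal_mult'[symmetric])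
qed

lemma prob_tail_pos_of_kernel_tail_pos:
  assumes X[measurable]: "X \<in> borel_measurable M" and Y[measurable]: "Y \<in> borel_measurable M"
    and rcl: "regular_conditional_law M X Y K"
    and [measurable]: "B \<in> sets borel"
    and pos: "AE y in distr M borel Y. measure (K y) {s<..} > 0"
    and B: "\<P>(\<omega> in M. Y \<omega> \<in> B) > 0"
  shows "\<P>(\<omega> in M. s < X \<omega> \<and> Y \<omega> \<in> B) > 0"
proof (rule ccontr)
  assume "\<not> ?thesis"
  then have "measure M {\<omega> \<in> space M. X \<omega> \<in> {s<..} \<and> Y \<omega> \<in> B} = 0"
    by (simp add: not_less measure_le_0_iff)
  then have zero: "emeasure M {\<omega> \<in> space M. (X \<omega>, Y \<omega>) \<in> {s<..} \<times> B} = 0"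
    by (simp add: emeasure_eq_measure)
  have K_prob: "K \<in> borel \<rightarrow>\<^sub>M prob_algebra borel"
    using rcl by (simp add: regular_conditional_law_def)
  have K[measurable]: "K \<in> borel \<rightarrow>\<^sub>M subprob_algebra borel"
    by (rule measurable_prob_algebraD[OF K_prob])
  have "emeasure (K y) {x. s < x \<and> y \<in> B} = emeasure (K y) {s<..} * indicator B y" for y
    by (auto simp: indicator_def greaterThan_def)
  then have "(\<integral>\<^sup>+ y. emeasure (K y) {s<..} * indicator B y \<partial>distr M borel Y) = 0"
    using joint_law_of_regular_conditional_law[OF X Y rcl, of "{s<..} \<times> B"] zero by simp
  then have "AE y in distr M borel Y. emeasure (K y) {s<..} * indicator B y = 0"
    by (subst (asm) nn_integral_0_iff_AE) simp_all
  then have "AE y in distr M borel Y. y \<notin> B"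
    using pos by eventually_elim (auto simp: measure_def indicator_def split: if_splits)
  then have "AE \<omega> in M. Y \<omega> \<notin> B"
    by (subst (asm) AE_distr_iff) auto
  then have "\<P>(\<omega> in M. Y \<omega> \<in> B) = 0"
    by (intro measure_eq_0_null_sets) (auto simp: AE_iff_null)
  with B show False by simp
qed

end

section \<open>Tails\<close>

lemma (in prob_space) survival_cdf_distr:
  assumes [measurable]: "Z \<in> borel_measurable M"
  shows "survival (cdf (distr M borel Z)) x = \<P>(\<omega> in M. x < Z \<omega>)"
proof -
  have "cdf (distr M borel Z) x = \<P>(\<omega> in M. Z \<omega> \<le> x)"
    by (auto simp: cdf_def measure_distr vimage_def Int_def conj_commute)
  also have "\<dots> = 1 - \<P>(\<omega> in M. \<not> Z \<omega> \<le> x)"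
    by (subst prob_neg) simp_all
  finally show ?thesis by (simp add: survival_def not_le)
qed

lemma Limsup_less_PInfty_iff_eventually_le:
  fixes r :: "real \<Rightarrow> real"
  shows "Limsup at_top (\<lambda>x. ereal (r x)) < \<infinity> \<longleftrightarrow> (\<exists>C. eventually (\<lambda>x. r x \<le> C) at_top)"
proof
  assume "Limsup at_top (\<lambda>x. ereal (r x)) < \<infinity>"
  then obtain C where "Limsup at_top (\<lambda>x. ereal (r x)) < ereal C"
    by (metis ereal_dense2)
  then have "eventually (\<lambda>x. ereal (r x) < ereal C) at_top"
    by (rule Limsup_lessD)
  then have "eventually (\<lambda>x. r x \<le> C) at_top"
    by eventually_elim simp
  then show "\<exists>C. eventually (\<lambda>x. r x \<le> C) at_top" ..
next
  assume "\<exists>C. eventually (\<lambda>x. r x \<le> C) at_top"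
  then obtain C where "eventually (\<lambda>x. r x \<le> C) at_top" ..
  then have "Limsup at_top (\<lambda>x. ereal (r x)) \<le> ereal C"
    by (intro Limsup_bounded) simp
  then show "Limsup at_top (\<lambda>x. ereal (r x)) < \<infinity>"
    by (rule le_less_trans) simp
qed

lemma generalized_long_tailed_iff:
  "generalized_long_tailed F \<longleftrightarrow> (\<forall>x\<ge>0. survival F x > 0) \<and>
    (\<forall>a>0. \<exists>C. eventually (\<lambda>x. survival F (x - a) \<le> C * survival F x) at_top)"
proof (cases "\<forall>x\<ge>0. survival F x > 0")
  case True
  have pos: "eventually (\<lambda>x. survival F x > 0) at_top"
    using eventually_ge_at_top[of 0] by eventually_elim (use True in auto)
  have "(eventually (\<lambda>x. survival F (x - a) / survival F x \<le> C) at_top) =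
      (eventually (\<lambda>x. survival F (x - a) \<le> C * survival F x) at_top)" for a C
    by (rule eventually_subst) (use pos in eventually_elim, simp add: pos_divide_le_eq)
  with True show ?thesis
    unfolding generalized_long_tailed_def Limsup_less_PInfty_iff_eventually_le by simp
qed (auto simp: generalized_long_tailed_def)

text \<open>
Once the relative error is below \<open>1/2\<close>, each \<open>k y s\<close> lies between \<open>h y * f s / 2\<close> and
\<open>3 * h y * f s / 2\<close>; in a quotient of two such values \<open>h y\<close> cancels and the constant becomes \<open>3\<close>.
\<close>

lemma uniform_tail_equivalence_imp_comparable:
  fixes k :: "'b \<Rightarrow> real \<Rightarrow> real" and f :: "real \<Rightarrow> real" and h :: "'b \<Rightarrow> real"
  assumes lim: "((\<lambda>x. SUP y\<in>S. ereal \<bar>k y x / (h y * f x) - 1\<bar>) \<longlongrightarrow> 0) at_top"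
    and h: "\<And>y. y \<in> S \<Longrightarrow> h y > 0" and f: "\<And>x. x \<ge> 0 \<Longrightarrow> f x > 0"
  obtains x0 where "x0 \<ge> 0" "\<And>y s. y \<in> S \<Longrightarrow> s \<ge> x0 \<Longrightarrow> k y s > 0"
    "\<And>y s t. y \<in> S \<Longrightarrow> s \<ge> x0 \<Longrightarrow> t \<ge> x0 \<Longrightarrow> k y s \<le> 3 * (f s / f t) * k y t"
proof -
  have "eventually (\<lambda>x. (SUP y\<in>S. ereal \<bar>k y x / (h y * f x) - 1\<bar>) < ereal (1/2)) at_top"
    using lim by (rule order_tendstoD(2)) simp
  then obtain x1 where x1: "\<And>x. x \<ge> x1 \<Longrightarrow> (SUP y\<in>S. ereal \<bar>k y x / (h y * f x) - 1\<bar>) < ereal (1/2)"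
    by (auto simp: eventually_at_top_linorder)
  define x0 where "x0 = max 0 x1"
  have bounds: "h y * f s / 2 \<le> k y s" "k y s \<le> 3 * (h y * f s) / 2" "h y * f s > 0"
    if "y \<in> S" "s \<ge> x0" for y s
  proof -
    have "ereal \<bar>k y s / (h y * f s) - 1\<bar> \<le> (SUP y\<in>S. ereal \<bar>k y s / (h y * f s) - 1\<bar>)"
      using that(1) by (rule SUP_upper)
    also have "\<dots> < ereal (1/2)"
      using that(2) by (intro x1) (simp add: x0_def)
    finally have "\<bar>k y s / (h y * f s) - 1\<bar> < 1/2"
      by (simp only: less_ereal.simps)
    then have *: "1/2 \<le> k y s / (h y * f s)" "k y s / (h y * f s) \<le> 3/2"
      by linarith+
    show pos: "h y * f s > 0"
      using that h f by (simp add: x0_def)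
    show "h y * f s / 2 \<le> k y s" "k y s \<le> 3 * (h y * f s) / 2"
      using * by (simp_all add: pos_le_divide_eq[OF pos] pos_divide_le_eq[OF pos])
  qed
  show thesis
  proof
    show "x0 \<ge> 0" by (simp add: x0_def)
    show "k y s > 0" if "y \<in> S" "s \<ge> x0" for y s
      using bounds[OF that] by linarith
    show "k y s \<le> 3 * (f s / f t) * k y t" if "y \<in> S" "s \<ge> x0" "t \<ge> x0" for y s t
    proof -
      have pos: "f s > 0" "f t > 0" using that f by (simp_all add: x0_def)
      have "k y s \<le> 3 * (f s / f t) * (h y * f t / 2)"
        using bounds(2)[OF that(1,2)] pos by (simp add: field_simps)
      also have "\<dots> \<le> 3 * (f s / f t) * k y t"
        using bounds(1)[OF that(1,3)] pos by (intro mult_left_mono) simp_all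
      finally show ?thesis .
    qed
  qed
qed

section \<open>The tail of the product\<close>

theorem theorem2p4:
  fixes M :: "'a measure" and X Y :: "'a \<Rightarrow> real" and F G H :: "real \<Rightarrow> real"
    and K :: "real \<Rightarrow> real measure"
  assumes "prob_space M"
    and "X \<in> borel_measurable M" and "Y \<in> borel_measurable M"
    and "AE \<omega> in M. 0 \<le> X \<omega>" and "AE \<omega> in M. 0 \<le> Y \<omega>"
    and F: "F = cdf (distr M borel X)"
    and G: "G = cdf (distr M borel Y)"
    and H: "H = cdf (distr M borel (\<lambda>\<omega>. X \<omega> * Y \<omega>))"
    and F_tail: "\<forall>x\<ge>0. survival F x > 0"
    and "(G \<longlongrightarrow> 0) (at_left 0)" and "G 0 < 1"
    and K: "regular_conditional_law M X Y K"
    and A: "\<forall>c>0. (\<lambda>x. survival G (c * x)) \<in> o[at_top](survival H)"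
    and B: "\<exists>h \<in> {0..} \<rightarrow> {0<..}.
      ((\<lambda>x. SUP y\<in>measure_support (distr M borel Y).
          ereal \<bar>measure (K y) {x<..} / (h y * survival F x) - 1\<bar>) \<longlongrightarrow> 0) at_top"
    and OL: "generalized_long_tailed F"
  shows "generalized_long_tailed H"
proof -
  interpret prob_space M by fact
  note X[measurable] = \<open>X \<in> borel_measurable M\<close> and Y[measurable] = \<open>Y \<in> borel_measurable M\<close>
  note Y_nonneg = \<open>AE \<omega> in M. 0 \<le> Y \<omega>\<close>
  let ?\<mu> = "distr M borel Y"
  have F_eq: "survival F x = \<P>(\<omega> in M. x < X \<omega>)" for x
    unfolding F by (rule survival_cdf_distr) measurable
  have G_eq: "survival G x = \<P>(\<omega> in M. x < Y \<omega>)" for x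
    unfolding G by (rule survival_cdf_distr) measurable
  have H_eq: "survival H x = \<P>(\<omega> in M. x < X \<omega> * Y \<omega>)" for x
    unfolding H by (rule survival_cdf_distr) measurable
  have F_antimono: "survival F t \<le> survival F s" if "s \<le> t" for s t
    unfolding F_eq using that by (intro finite_measure_mono) auto
  have H_antimono: "survival H t \<le> survival H s" if "s \<le> t" for s t
    unfolding H_eq using that by (intro finite_measure_mono) auto

  have supp: "AE y in ?\<mu>. y \<in> measure_support ?\<mu>"
    by (rule AE_measure_support) simp
  have supp_nonneg: "measure_support ?\<mu> \<subseteq> {0..}"
    using Y_nonneg by (intro measure_support_subset_closed) (auto simp: AE_distr_iff)
  from B obtain h where h: "h \<in> {0..} \<rightarrow> {0<..}"
    and h_lim: "((\<lambda>x. SUP y\<in>measure_support ?\<mu>.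
      ereal \<bar>measure (K y) {x<..} / (h y * survival F x) - 1\<bar>) \<longlongrightarrow> 0) at_top"
    by blast
  have h_pos: "h y > 0" if "y \<in> measure_support ?\<mu>" for y
    using that h supp_nonneg by fastforce
  obtain x0 where x0: "x0 \<ge> 0"
    and K_pos: "\<And>y s. y \<in> measure_support ?\<mu> \<Longrightarrow> s \<ge> x0 \<Longrightarrow> measure (K y) {s<..} > 0"
    and K_le: "\<And>y s t. y \<in> measure_support ?\<mu> \<Longrightarrow> s \<ge> x0 \<Longrightarrow> t \<ge> x0 \<Longrightarrow>
      measure (K y) {s<..} \<le> 3 * (survival F s / survival F t) * measure (K y) {t<..}"
    using F_tail
    by (rule_tac uniform_tail_equivalence_imp_comparable[OF h_lim h_pos]) auto

  obtain d where d: "d > 0" and d_prob: "\<P>(\<omega> in M. Y \<omega> \<in> {d<..}) > 0"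
  proof -
    have "\<exists>n. \<not> (AE \<omega> in M. Y \<omega> \<le> 1 / Suc n)"
    proof (rule ccontr)
      assume "\<not> ?thesis"
      then have "AE \<omega> in M. \<forall>n. Y \<omega> \<le> 1 / Suc n"
        by (simp add: AE_all_countable)
      then have "AE \<omega> in M. Y \<omega> \<le> 0"
      proof eventually_elim
        case (elim \<omega>)
        then show ?case
          by (metis linorder_not_less nat_approx_posE less_le_not_le of_nat_Suc)
      qed
      then have "survival G 0 = 0"
        unfolding G_eq by (intro measure_eq_0_null_sets) (auto simp: AE_iff_null not_le)
      with \<open>G 0 < 1\<close> show False by (simp add: survival_def)
    qed
    then obtain n where n: "\<not> (AE \<omega> in M. Y \<omega> \<le> 1 / Suc n)" ..
    have "\<P>(\<omega> in M. Y \<omega> \<in> {1 / Suc n<..}) \<noteq> 0"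
    proof
      assume "\<P>(\<omega> in M. Y \<omega> \<in> {1 / Suc n<..}) = 0"
      then have "AE \<omega> in M. \<not> Y \<omega> \<in> {1 / Suc n<..}"
        by (subst AE_iff_measurable[OF _ refl]) (auto simp: emeasure_eq_measure)
      with n show False by (simp add: not_less)
    qed
    then show thesis
      by (intro that[of "1 / Suc n"]) (auto simp: zero_less_measure_iff)
  qed

  define q where "q = \<P>(\<omega> in M. x0 < X \<omega> \<and> Y \<omega> \<in> {d<..})"
  have q: "q > 0"
    unfolding q_def
  proof (rule prob_tail_pos_of_kernel_tail_pos[OF X Y K _ _ d_prob])
    show "AE y in ?\<mu>. measure (K y) {x0<..} > 0"
      using supp by eventually_elim (simp add: K_pos)
  qed simp
  \<comment> \<open>Comparing the conditional tails at the fixed level \<open>x0\<close> with those at \<open>x / d\<close> bounds the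
    probability that \<open>X > x / d\<close> and \<open>Y > d\<close> from below.\<close>
  have H_lower: "q * survival F (x / d) \<le> 3 * survival F x0 * survival H x" if x: "x \<ge> d * x0" for x
  proof -
    have x': "x / d \<ge> x0" using x d by (simp add: field_simps)
    then have Fpos: "survival F (x / d) > 0" "survival F x0 > 0" using F_tail x0 by auto
    have "q \<le> 3 * (survival F x0 / survival F (x / d)) * \<P>(\<omega> in M. x / d < X \<omega> \<and> Y \<omega> \<in> {d<..})"
      unfolding q_def
    proof (rule prob_tail_le_of_kernel_tail_le[OF X Y K])
      show "AE y in ?\<mu>. y \<in> {d<..} \<longrightarrow> measure (K y) {x0<..} \<le>
          3 * (survival F x0 / survival F (x / d)) * measure (K y) {x / d<..}"
        using supp by eventually_elim (use K_le x' in auto)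
    qed (use Fpos in auto)
    also have "\<P>(\<omega> in M. x / d < X \<omega> \<and> Y \<omega> \<in> {d<..}) \<le> survival H x"
      unfolding H_eq
    proof (rule finite_measure_mono)
      show "{\<omega> \<in> space M. x / d < X \<omega> \<and> Y \<omega> \<in> {d<..}} \<subseteq> {\<omega> \<in> space M. x < X \<omega> * Y \<omega>}"
      proof (intro Collect_mono impI conjI; (elim conjE)?)
        fix \<omega> assume *: "x / d < X \<omega>" "Y \<omega> \<in> {d<..}"
        have "x < X \<omega> * d" using *(1) d by (simp add: pos_divide_less_eq)
        also have "\<dots> \<le> X \<omega> * Y \<omega>" using * x' x0 by (intro mult_left_mono) auto
        finally show "x < X \<omega> * Y \<omega>" .
      qed
    qed simp
    finally show ?thesis
      using Fpos by (simp add: field_simps)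
  qed

  \<comment> \<open>The lower bound holds at large arguments; monotonicity carries positivity to all others.\<close>
  have H_pos: "survival H x > 0" for x
  proof -
    define z where "z = max x (d * x0)"
    have "0 \<le> d * x0" using d x0 by simp
    then have "z / d \<ge> 0" using d by (simp add: z_def)
    then have "0 < q * survival F (z / d)" using q F_tail by simp
    also have "\<dots> \<le> 3 * survival F x0 * survival H z"
      by (rule H_lower) (simp add: z_def)
    finally have "survival H z > 0"
      using F_tail[rule_format, OF x0] by (simp add: zero_less_mult_iff)
    with H_antimono[of x z] show ?thesis by (simp add: z_def)
  qed

  have "\<exists>C. eventually (\<lambda>x. survival H (x - a) \<le> C * survival H x) at_top" if a: "a > 0" for a
  proof -
    define b where "b = 2 * a / d"
    have b: "b > 0" using a d by (simp add: b_def)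
    with OL obtain C where "eventually (\<lambda>x. survival F (x - b) \<le> C * survival F x) at_top"
      by (auto simp: generalized_long_tailed_iff)
    then obtain x1 where x1: "\<And>x. x \<ge> x1 \<Longrightarrow> survival F (x - b) \<le> C * survival F x"
      by (auto simp: eventually_at_top_linorder)
    \<comment> \<open>For \<open>x / y \<ge> T\<close> the level \<open>x / y\<close> is in the range where \<open>F\<close> controls a shift by \<open>b\<close>, and
      even the shifted level \<open>x / y - b\<close> is at least \<open>x0\<close>, where conditional tails are comparable.\<close>
    define T where "T = max x1 (x0 + b)"
    have T: "T \<ge> x1" "T \<ge> x0 + b" "T > 0" using x0 b by (auto simp: T_def)
    have C: "C \<ge> 0"
    proof -
      have "0 \<le> survival F (T - b)" by (simp add: F_eq)
      also have "\<dots> \<le> C * survival F T" using T(1) by (rule x1)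
      finally show ?thesis using F_tail[rule_format, of T] T(3) by (simp add: zero_le_mult_iff)
    qed
    have "eventually (\<lambda>x. norm (survival G (1 / T * x)) \<le> 1 * norm (survival H x)) at_top"
      using A[rule_format, of "1 / T"] T(3) by (intro landau_o.smallD) simp_all
    then have "eventually (\<lambda>x. survival H (x - a) \<le> (3 * survival F x0 / q + 3 * C + 1) * survival H x) at_top"
      using eventually_ge_at_top[of "2 * a"] eventually_ge_at_top[of "d * x0"]
    proof eventually_elim
      case (elim x)
      have xa: "x - a > 0" using elim a by simp
      have large: "\<P>(\<omega> in M. x / T < Y \<omega>) \<le> survival H x"
        using elim(1) H_pos[of x] by (simp add: G_eq)
      have small: "\<P>(\<omega> in M. x / d < X \<omega>) \<le> 3 * survival F x0 / q * survival H x"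
        using H_lower[OF elim(3)] q by (simp add: F_eq field_simps)
      have "\<P>(\<omega> in M. (x - a) / Y \<omega> < X \<omega> \<and> Y \<omega> \<in> {d/2<..x/T}) \<le>
          3 * C * \<P>(\<omega> in M. x / Y \<omega> < X \<omega> \<and> Y \<omega> \<in> {d/2<..x/T})"
      proof (rule prob_tail_le_of_kernel_tail_le[OF X Y K])
        show "AE y in ?\<mu>. y \<in> {d/2<..x/T} \<longrightarrow>
            measure (K y) {(x - a) / y<..} \<le> 3 * C * measure (K y) {x / y<..}"
          using supp
        proof eventually_elim
          fix y assume y: "y \<in> measure_support ?\<mu>"
          show "y \<in> {d/2<..x/T} \<longrightarrow>
              measure (K y) {(x - a) / y<..} \<le> 3 * C * measure (K y) {x / y<..}"
          proof
            assume yr: "y \<in> {d/2<..x/T}"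
            then have ypos: "y > 0" using d by simp
            have xy: "x / y \<ge> T" using yr ypos T(3) by (simp add: field_simps)
            have "a / y \<le> b" using yr ypos d a by (simp add: b_def field_simps)
            then have shift: "x / y - b \<le> (x - a) / y" by (simp add: diff_divide_distrib)
            have pos: "survival F (x / y) > 0" using F_tail xy T(3) by simp
            have "survival F ((x - a) / y) \<le> survival F (x / y - b)"
              using shift by (rule F_antimono)
            also have "\<dots> \<le> C * survival F (x / y)" using xy T(1) by (intro x1) simp
            finally have ratio: "survival F ((x - a) / y) / survival F (x / y) \<le> C"
              using pos by (simp add: pos_divide_le_eq)
            have "measure (K y) {(x - a) / y<..} \<le>
                3 * (survival F ((x - a) / y) / survival F (x / y)) * measure (K y) {x / y<..}"
              using xy shift T b by (intro K_le[OF y]) auto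
            also have "\<dots> \<le> 3 * C * measure (K y) {x / y<..}"
              using ratio by (intro mult_right_mono) auto
            finally show "measure (K y) {(x - a) / y<..} \<le> 3 * C * measure (K y) {x / y<..}" .
          qed
        qed
      qed (use C in auto)
      also have "\<dots> \<le> 3 * C * survival H x"
        unfolding H_eq using d C
        by (intro mult_left_mono finite_measure_mono) (auto simp: pos_divide_less_eq)
      finally have mid: "\<P>(\<omega> in M. (x - a) / Y \<omega> < X \<omega> \<and> Y \<omega> \<in> {d/2<..x/T}) \<le> 3 * C * survival H x" .
      let ?S = "{\<omega> \<in> space M. x / d < X \<omega>}"
      let ?I = "{\<omega> \<in> space M. (x - a) / Y \<omega> < X \<omega> \<and> Y \<omega> \<in> {d/2<..x/T}}"
      let ?L = "{\<omega> \<in> space M. x / T < Y \<omega>}"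
      have "survival H (x - a) \<le> measure M (?S \<union> ?I \<union> ?L)"
        unfolding H_eq
      proof (rule finite_measure_mono_AE)
        show "AE \<omega> in M. \<omega> \<in> {\<omega> \<in> space M. x - a < X \<omega> * Y \<omega>} \<longrightarrow> \<omega> \<in> ?S \<union> ?I \<union> ?L"
          using Y_nonneg
        proof eventually_elim
          fix \<omega> assume nonneg: "0 \<le> Y \<omega>"
          show "\<omega> \<in> {\<omega> \<in> space M. x - a < X \<omega> * Y \<omega>} \<longrightarrow> \<omega> \<in> ?S \<union> ?I \<union> ?L"
          proof
            assume w: "\<omega> \<in> {\<omega> \<in> space M. x - a < X \<omega> * Y \<omega>}"
            then have "Y \<omega> \<noteq> 0" using xa by auto
            with nonneg have Ypos: "Y \<omega> > 0" by simp
            have quot: "(x - a) / Y \<omega> < X \<omega>" using w Ypos by (simp add: pos_divide_less_eq)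
            have "x / d < X \<omega>" if "Y \<omega> \<le> d / 2"
            proof -
              \<comment> \<open>equivalent to \<open>x \<ge> 2 * a\<close>\<close>
              have "x / d \<le> (x - a) / (d / 2)" using elim(2) d by (simp add: field_simps)
              also have "\<dots> \<le> (x - a) / Y \<omega>" using that xa Ypos by (intro divide_left_mono) auto
              finally show ?thesis using quot by simp
            qed
            with w quot show "\<omega> \<in> ?S \<union> ?I \<union> ?L" by (cases "Y \<omega> \<le> d / 2") auto
          qed
        qed
      qed measurable
      also have "\<dots> \<le> measure M ?S + measure M ?I + measure M ?L"
        by (intro order_trans[OF measure_Un_le] add_mono order_refl measure_Un_le) measurable
      also have "\<dots> \<le> (3 * survival F x0 / q + 3 * C + 1) * survival H x"
        using small mid large by (simp add: algebra_simps)
      finally show ?case .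
    qed
    then show ?thesis ..
  qed
  then show ?thesis
    using H_pos by (simp add: generalized_long_tailed_iff)
qed

end
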